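(* Let $\mathbf I=(I,\vee,\wedge,\rightarrow,1)$ be a non-classical implication semilattice. For every $x\in I$ let ${}^x$ be the unary operation on $[x,1]$ defined by $y^x:=y\rightarrow x$ for all $y\in[x,1]$. Then $\mathbb S(\mathbf I):=(I,\vee,\wedge,({}^x;x\in I),1)$ is a join-semilattice whose sections are pseudocomplemented lattices.
   Context: In a join-semilattice $(S,\vee,1)$ with top element $1$, the order is $x\leq y$ iff $x\vee y=y$, and $[x,1]:=\{y\in S: x\leq y\}$ (a section, i.e. principal filter). Throughout, $x\wedge y$ denotes the infimum of $x$ and $y$ in $S$, a partial operation. A pseudocomplemented lattice is a lattice $(L,\vee,\wedge)$ with bottom element $0$ and a unary operation ${}^*$ such that for every $x\in L$, $x^*$ is the greatest $y\in L$ with $x\wedge y=0$. A join-semilattice whose sections are pseudocomplemented lattices is a quintuple $(S,\vee,\wedge,({}^x;x\in S),1)$ where $(S,\vee,1)$ is a join-semilattice with top element $1$, $x\wedge y$ is defined if and only if $x$ and $y$ have a common lower bound, and for every $x\in S$, ${}^x$ is a unary operation on $[x,1]$ such that $([x,1],\vee,\wedge,{}^x)$ is a pseudocomplemented lattice (with bottom element $x$). A non-classical implication semilattice is a quintuple $(S,\vee,\wedge,\rightarrow,1)$ where $(S,\vee,1)$ is a join-semilattice with top element $1$, the infimum $x\wedge y$ exists if and only if $x$ and $y$ have a common lower bound, and $\rightarrow$ is a binary operation on $S$ such that for all $x,y,z\in S$: (1) $y\leq x\rightarrow y$; (2) $(x\vee y)\wedge(x\rightarrow y)=y$; (3) $(x\vee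 y)\rightarrow y=x\rightarrow y$; (4) $y\leq(x\vee z)\rightarrow\big((x\vee z)\wedge(y\vee z)\big)$. *)

theory Defs
  imports "HOL-Algebra.Lattice"
begin

text \<open>
  All structures have an explicit carrier \<open>S\<close>; the operations are only constrained on \<open>S\<close>.
  The partial operation meet is an option-valued function, with \<open>None\<close> for undefined.
\<close>

definition join_order :: "'a set \<Rightarrow> ('a \<Rightarrow> 'a \<Rightarrow> 'a) \<Rightarrow> 'a gorder" where
  "join_order S vee = \<lparr>carrier = S, eq = (=), le = (\<lambda>x y. vee x y = y)\<rparr>"

definition principal_filter :: "'a set \<Rightarrow> ('a \<Rightarrow> 'a \<Rightarrow> 'a) \<Rightarrow> 'a \<Rightarrow> 'a set" where
  "principal_filter S vee x = {y \<in> S. x \<sqsubseteq>\<^bsub>join_order S vee\<^esub> y}"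

locale join_semilattice_with_top =
  fixes S :: "'a set" and vee :: "'a \<Rightarrow> 'a \<Rightarrow> 'a" and one :: 'a
  assumes vee_closed: "\<lbrakk>x \<in> S; y \<in> S\<rbrakk> \<Longrightarrow> vee x y \<in> S"
    and one_closed: "one \<in> S"
    and vee_assoc: "\<lbrakk>x \<in> S; y \<in> S; z \<in> S\<rbrakk> \<Longrightarrow> vee (vee x y) z = vee x (vee y z)"
    and vee_comm: "\<lbrakk>x \<in> S; y \<in> S\<rbrakk> \<Longrightarrow> vee x y = vee y x"
    and vee_idem: "x \<in> S \<Longrightarrow> vee x x = x"
    and vee_one: "x \<in> S \<Longrightarrow> vee x one = one"

locale join_semilattice_with_partial_meet = join_semilattice_with_top S vee one
  for S :: "'a set" and vee :: "'a \<Rightarrow> 'a \<Rightarrow> 'a" and one :: 'a +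
  fixes wedge :: "'a \<Rightarrow> 'a \<Rightarrow> 'a option"
  assumes wedge_eq_Some_iff: "\<lbrakk>x \<in> S; y \<in> S\<rbrakk> \<Longrightarrow>
      wedge x y = Some g \<longleftrightarrow>
        is_glb (join_order S vee) g {x, y}"
    and wedge_defined_iff: "\<lbrakk>x \<in> S; y \<in> S\<rbrakk> \<Longrightarrow>
      wedge x y \<noteq> None \<longleftrightarrow> Lower (join_order S vee) {x, y} \<noteq> {}"

locale pseudocomplemented_lattice = lattice L
  for L (structure) +
  fixes zero :: 'a and star :: "'a \<Rightarrow> 'a"
  assumes zero_least: "least L zero (carrier L)"
    and star_greatest: "x \<in> carrier L \<Longrightarrow>
      greatest L (star x) {y \<in> carrier L. x \<sqinter> y = zero}"

text \<open>
  The value \<open>pc x y\<close> stands for \<open>y\<^sup>x\<close> and is meaningful only for \<open>x \<in> S\<close> and \<open>y\<close> in the section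
  \<open>[x,1]\<close>. Library lattices carry only an order, so the last two assumptions say that the
  lattice operations of a section are the restrictions of the given \<open>vee\<close> and \<open>wedge\<close>.
\<close>

locale semilattice_with_pseudocomplemented_sections =
  join_semilattice_with_partial_meet S vee one wedge
  for S :: "'a set" and vee :: "'a \<Rightarrow> 'a \<Rightarrow> 'a" and wedge :: "'a \<Rightarrow> 'a \<Rightarrow> 'a option"
    and pc :: "'a \<Rightarrow> 'a \<Rightarrow> 'a" and one :: 'a +
  assumes section_pseudocomplemented: "x \<in> S \<Longrightarrow>
      pseudocomplemented_lattice (join_order (principal_filter S vee x) vee) x (pc x)"
    and section_join:
      "\<lbrakk>x \<in> S; a \<in> principal_filter S vee x; b \<in> principal_filter S vee x\<rbrakk> \<Longrightarrow>
        vee a b = a \<squnion>\<^bsub>join_order (principal_filter S vee x) vee\<^esub> b"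
    and section_meet:
      "\<lbrakk>x \<in> S; a \<in> principal_filter S vee x; b \<in> principal_filter S vee x\<rbrakk> \<Longrightarrow>
        wedge a b = Some (a \<sqinter>\<^bsub>join_order (principal_filter S vee x) vee\<^esub> b)"

text \<open>
  In \<open>imp4\<close> the meet is defined, because \<open>z\<close> is a common lower bound of its arguments.
\<close>

locale nonclassical_implication_semilattice =
  join_semilattice_with_partial_meet S vee one wedge
  for S :: "'a set" and vee :: "'a \<Rightarrow> 'a \<Rightarrow> 'a" and wedge :: "'a \<Rightarrow> 'a \<Rightarrow> 'a option"
    and imp :: "'a \<Rightarrow> 'a \<Rightarrow> 'a" and one :: 'a +
  assumes imp_closed: "\<lbrakk>x \<in> S; y \<in> S\<rbrakk> \<Longrightarrow> imp x y \<in> S"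
    and imp1: "\<lbrakk>x \<in> S; y \<in> S\<rbrakk> \<Longrightarrow> y \<sqsubseteq>\<^bsub>join_order S vee\<^esub> imp x y"
    and imp2: "\<lbrakk>x \<in> S; y \<in> S\<rbrakk> \<Longrightarrow> wedge (vee x y) (imp x y) = Some y"
    and imp3: "\<lbrakk>x \<in> S; y \<in> S\<rbrakk> \<Longrightarrow> imp (vee x y) y = imp x y"
    and imp4: "\<lbrakk>x \<in> S; y \<in> S; z \<in> S\<rbrakk> \<Longrightarrow>
      y \<sqsubseteq>\<^bsub>join_order S vee\<^esub> imp (vee x z) (the (wedge (vee x z) (vee y z)))"

end

theory Submission
  imports Defs
begin

text \<open>
  For \<open>a\<close> and \<open>b\<close> in the section \<open>[x,1]\<close> with \<open>a \<and> b = x\<close>, axiom (4) with \<open>z = x\<close> reads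
  \<open>b \<le> a \<rightarrow> (a \<and> b) = a \<rightarrow> x\<close>, while axiom (2) gives \<open>a \<and> (a \<rightarrow> x) = x\<close>.
  Hence \<open>a \<rightarrow> x\<close>, which lies in the section by (1), is the pseudocomplement of \<open>a\<close>.
\<close>

context join_semilattice_with_top
begin

lemma carrier_join_order [simp]: "carrier (join_order A vee) = A"
  and le_join_order [simp]: "x \<sqsubseteq>\<^bsub>join_order A vee\<^esub> y \<longleftrightarrow> vee x y = y"
  and eq_join_order [simp]: "x .=\<^bsub>join_order A vee\<^esub> y \<longleftrightarrow> x = y"
  by (simp_all add: join_order_def)

lemma mem_filter [simp]: "y \<in> principal_filter S vee x \<longleftrightarrow> y \<in> S \<and> vee x y = y"
  by (simp add: principal_filter_def)

lemma partial_order_join_order: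
  assumes "A \<subseteq> S"
  shows "partial_order (join_order A vee)"
proof
  show "(.=\<^bsub>join_order A vee\<^esub>) = (=)" by (simp add: join_order_def)
next
  fix x y z
  assume "x \<sqsubseteq>\<^bsub>join_order A vee\<^esub> y" "y \<sqsubseteq>\<^bsub>join_order A vee\<^esub> z"
    "x \<in> carrier (join_order A vee)" "y \<in> carrier (join_order A vee)"
    "z \<in> carrier (join_order A vee)"
  then show "x \<sqsubseteq>\<^bsub>join_order A vee\<^esub> z"
    using assms by simp (metis subsetD vee_assoc)
qed (use assms vee_idem vee_comm in \<open>auto, metis subsetD vee_comm\<close>)

text \<open>A section is upward closed, so it contains the join in \<open>S\<close> of any two of
  its elements, and that join stays least among the fewer upper bounds.\<close>

lemma is_lub_filter:
  assumes "x \<in> S" "a \<in> principal_filter S vee x" "b \<in> principal_filter S vee x"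
  shows "is_lub (join_order (principal_filter S vee x) vee) (vee a b) {a, b}"
proof -
  have ab: "a \<in> S" "b \<in> S" "vee x a = a" using assms by simp_all
  have "vee x (vee a b) = vee a b" "vee a (vee a b) = vee a b" "vee b (vee a b) = vee a b"
    using ab assms(1) by (metis vee_assoc vee_idem vee_comm vee_closed)+
  moreover have "vee (vee a b) c = c" if "c \<in> S" "vee a c = c" "vee b c = c" for c
    using that ab by (metis vee_assoc)
  ultimately show ?thesis
    using ab assms vee_closed by (auto simp: least_def Upper_def)
qed

end

context join_semilattice_with_partial_meet
begin

text \<open>Unpacks \<open>is_glb\<close> into equations between values of \<open>vee\<close>, the
  form in which the later proofs use the order.\<close>

lemma wedge_SomeD:
  assumes "a \<in> S" "b \<in> S" "wedge a b = Some g"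
  shows "g \<in> S" "vee g a = a" "vee g b = b"
    "\<And>c. \<lbrakk>c \<in> S; vee c a = a; vee c b = b\<rbrakk> \<Longrightarrow> vee c g = g"
  using assms wedge_eq_Some_iff[of a b g] by (auto simp: greatest_def Lower_def)

lemma wedge_filter:
  assumes "x \<in> S" "a \<in> principal_filter S vee x" "b \<in> principal_filter S vee x"
  obtains g where "wedge a b = Some g"
    "is_glb (join_order (principal_filter S vee x) vee) g {a, b}"
proof -
  \<comment> \<open>The bottom \<open>x\<close> of the section is a common lower bound, which is
    exactly what makes the partial meet defined.\<close>
  have "x \<in> Lower (join_order S vee) {a, b}"
    using assms by (auto simp: Lower_def)
  then obtain g where g: "wedge a b = Some g"
    using assms wedge_defined_iff[of a b] by auto
  \<comment> \<open>As \<open>x\<close> is a lower bound and \<open>g\<close> the greatest one in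
    \<open>S\<close>, \<open>x\<close> lies below \<open>g\<close>; so \<open>g\<close> is in the
    section.\<close>
  have "is_glb (join_order (principal_filter S vee x) vee) g {a, b}"
    using wedge_SomeD[OF _ _ g] assms by (auto simp: greatest_def Lower_def)
  with g show thesis by (rule that)
qed

lemma lattice_filter:
  assumes "x \<in> S"
  shows "lattice (join_order (principal_filter S vee x) vee)"
proof -
  interpret partial_order "join_order (principal_filter S vee x) vee"
    by (rule partial_order_join_order) auto
  show ?thesis
  proof
    fix a b
    assume ab: "a \<in> carrier (join_order (principal_filter S vee x) vee)"
      "b \<in> carrier (join_order (principal_filter S vee x) vee)"
    show "\<exists>s. is_lub (join_order (principal_filter S vee x) vee) s {a, b}"
      using is_lub_filter[OF assms] ab by fastforce
    show "\<exists>s. is_glb (join_order (principal_filter S vee x) vee) s {a, b}"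
      using wedge_filter[OF assms] ab by (metis carrier_join_order)
  qed
qed

text \<open>The library join is some chosen least upper bound; uniqueness in a partial order
  identifies it with \<open>vee a b\<close>.\<close>

lemma join_filter:
  assumes "x \<in> S" "a \<in> principal_filter S vee x" "b \<in> principal_filter S vee x"
  shows "a \<squnion>\<^bsub>join_order (principal_filter S vee x) vee\<^esub> b = vee a b"
proof -
  interpret L: lattice "join_order (principal_filter S vee x) vee"
    by (rule lattice_filter[OF assms(1)])
  show ?thesis
    using L.least_unique[OF L.sup_of_two_least is_lub_filter[OF assms]] assms
    by (simp add: join_def)
qed

lemma meet_filter:
  assumes "x \<in> S" "a \<in> principal_filter S vee x" "b \<in> principal_filter S vee x"
  shows "wedge a b = Some (a \<sqinter>\<^bsub>join_order (principal_filter S vee x) vee\<^esub> b)"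
proof -
  interpret L: lattice "join_order (principal_filter S vee x) vee"
    by (rule lattice_filter[OF assms(1)])
  obtain g where g: "wedge a b = Some g"
    "is_glb (join_order (principal_filter S vee x) vee) g {a, b}"
    using wedge_filter[OF assms] .
  then show ?thesis
    using L.greatest_unique[OF L.inf_of_two_greatest g(2)] assms
    by (simp add: meet_def)
qed

end

context nonclassical_implication_semilattice
begin

lemma wedge_imp:
  assumes "x \<in> S" "a \<in> principal_filter S vee x"
  shows "wedge a (imp a x) = Some x"
  using assms imp2[of a x] vee_comm[of a x] by simp

lemma le_imp:
  assumes "x \<in> S" "a \<in> principal_filter S vee x" "b \<in> S" "vee x b = b" "wedge a b = Some x"
  shows "vee b (imp a x) = imp a x"
  \<comment> \<open>Both \<open>a\<close> and \<open>b\<close> lie above \<open>x\<close>, so the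
    joins with \<open>x\<close> collapse and the meet inside axiom (4) becomes
    \<open>the (Some x)\<close>.\<close>
  using assms imp4[of a b x] vee_comm[of x a] vee_comm[of x b] by simp

text \<open>\<open>star\<close> is a separate function agreeing with \<open>imp\<close> on the
  section only, because \<open>pc x\<close> is unconstrained elsewhere.\<close>

lemma pseudocomplemented_filter:
  assumes "x \<in> S"
    and star: "\<And>a. a \<in> principal_filter S vee x \<Longrightarrow> star a = imp a x"
  shows "pseudocomplemented_lattice (join_order (principal_filter S vee x) vee) x star"
proof -
  let ?L = "join_order (principal_filter S vee x) vee"
  interpret L: lattice ?L
    by (rule lattice_filter[OF assms(1)])
  show ?thesis
  proof
    show "least ?L x (carrier ?L)"
      using assms(1) vee_idem by (auto simp: least_def)
  next
    fix a assume "a \<in> carrier ?L"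
    then have a: "a \<in> principal_filter S vee x" by simp
    have i: "imp a x \<in> principal_filter S vee x"
      using a assms(1) imp1[of a x] imp_closed by simp
    \<comment> \<open>Passes from the total meet of the section to the partial \<open>wedge\<close>
      in which the axioms are phrased.\<close>
    have meet_eq: "a \<sqinter>\<^bsub>?L\<^esub> b = x \<longleftrightarrow> wedge a b = Some x"
      if "b \<in> principal_filter S vee x" for b
      using meet_filter[OF assms(1) a that] by simp
    show "greatest ?L (star a) {b \<in> carrier ?L. a \<sqinter>\<^bsub>?L\<^esub> b = x}"
      unfolding star[OF a] greatest_def
      using i meet_eq wedge_imp[OF assms(1) a] le_imp[OF assms(1) a] by auto
  qed
qed

end

theorem theorem3p6:
  fixes I :: "'a set" and vee :: "'a \<Rightarrow> 'a \<Rightarrow> 'a" and wedge :: "'a \<Rightarrow> 'a \<Rightarrow> 'a option"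
    and imp :: "'a \<Rightarrow> 'a \<Rightarrow> 'a" and one :: 'a and pc :: "'a \<Rightarrow> 'a \<Rightarrow> 'a"
  assumes "nonclassical_implication_semilattice I vee wedge imp one"
    and "\<And>x y. \<lbrakk>x \<in> I; y \<in> principal_filter I vee x\<rbrakk> \<Longrightarrow> pc x y = imp y x"
  shows "semilattice_with_pseudocomplemented_sections I vee wedge pc one"
proof -
  interpret nonclassical_implication_semilattice I vee wedge imp one
    by (rule assms(1))
  show ?thesis
  proof (intro semilattice_with_pseudocomplemented_sections.intro
      semilattice_with_pseudocomplemented_sections_axioms.intro)
    show "join_semilattice_with_partial_meet I vee one wedge" ..
  next
    fix x assume x: "x \<in> I"
    show "pseudocomplemented_lattice (join_order (principal_filter I vee x) vee) x (pc x)"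
      using pseudocomplemented_filter[OF x] assms(2)[OF x] by blast
  next
    fix x a b
    assume *: "x \<in> I" "a \<in> principal_filter I vee x" "b \<in> principal_filter I vee x"
    show "vee a b = a \<squnion>\<^bsub>join_order (principal_filter I vee x) vee\<^esub> b"
      using join_filter[OF *] by simp
    show "wedge a b = Some (a \<sqinter>\<^bsub>join_order (principal_filter I vee x) vee\<^esub> b)"
      using meet_filter[OF *] .
  qed
qed

end
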